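(* Let $(X,T)$ be a topological dynamical system. Then $(X,T)$ is mean equicontinuous if and only if it is equicontinuous in the mean.
   Context: A topological dynamical system is a pair $(X,T)$ where $X$ is a non-empty compact metric space with metric $d$ and $T\colon X\to X$ is a continuous map (not assumed injective or surjective). $(X,T)$ is mean equicontinuous if for every $\varepsilon>0$ there exists $\delta>0$ such that whenever $x,y\in X$ with $d(x,y)<\delta$, we have $\limsup_{n\to\infty}\frac1n\sum_{i=0}^{n-1}d(T^ix,T^iy)<\varepsilon$. $(X,T)$ is equicontinuous in the mean if for every $\varepsilon>0$ there exists $\delta>0$ such that $\frac1n\sum_{i=0}^{n-1}d(T^ix,T^iy)<\varepsilon$ for all integers $n\ge 1$ and all $x,y\in X$ with $d(x,y)<\delta$. *)

theory Defs
  imports "HOL-Analysis.Analysis"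
begin

text \<open>The phase space is a subset \<open>X\<close> of the ambient metric space, with the restricted metric;
  \<open>T\<close> is only constrained on \<open>X\<close>.\<close>

definition topological_dynamical_system :: "'a::metric_space set \<Rightarrow> ('a \<Rightarrow> 'a) \<Rightarrow> bool" where
  "topological_dynamical_system X T \<longleftrightarrow>
     X \<noteq> {} \<and> compact X \<and> continuous_on X T \<and> T ` X \<subseteq> X"

definition orbit_mean :: "('a::metric_space \<Rightarrow> 'a) \<Rightarrow> nat \<Rightarrow> 'a \<Rightarrow> 'a \<Rightarrow> real" where
  "orbit_mean T n x y = (1 / real n) * (\<Sum>i<n. dist ((T ^^ i) x) ((T ^^ i) y))"

text \<open>The limit superior is taken in the extended reals, since \<open>limsup\<close> requires a complete lattice.\<close>

definition mean_equicontinuous :: "'a::metric_space set \<Rightarrow> ('a \<Rightarrow> 'a) \<Rightarrow> bool" where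
  "mean_equicontinuous X T \<longleftrightarrow>
     (\<forall>\<epsilon>>0. \<exists>\<delta>>0. \<forall>x\<in>X. \<forall>y\<in>X. dist x y < \<delta> \<longrightarrow>
        limsup (\<lambda>n. ereal (orbit_mean T n x y)) < ereal \<epsilon>)"

definition equicontinuous_in_the_mean :: "'a::metric_space set \<Rightarrow> ('a \<Rightarrow> 'a) \<Rightarrow> bool" where
  "equicontinuous_in_the_mean X T \<longleftrightarrow>
     (\<forall>\<epsilon>>0. \<exists>\<delta>>0. \<forall>n\<ge>1. \<forall>x\<in>X. \<forall>y\<in>X. dist x y < \<delta> \<longrightarrow> orbit_mean T n x y < \<epsilon>)"

end

(* For the hard direction, fix e > 0 and let P be the set of pairs whose orbit distance sums
   S_n grow at most like e n + O(1).  P is invariant under T x T, and by mean equicontinuity every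
   point q of its closure is close to P, so that S_n(q) < 4 e n for some n >= 1.  Compactness gives
   a single N such that each pair in P has such an n <= N; cutting orbits in P into blocks of
   length at most N bounds S_n by 4 e n + O(1), now uniformly on P.  Pairs of nearby points lie
   in P, and the finitely many remaining n are covered by uniform continuity. *)

theory Submission
  imports Defs
begin

text \<open>The average without its factor \<open>1 / real n\<close>: a Birkhoff sum of the distance
  along \<open>T \<times> T\<close>, which is additive over consecutive blocks of time, as averages
  are not.\<close>

definition orbit_sum :: "('a::metric_space \<Rightarrow> 'a) \<Rightarrow> nat \<Rightarrow> 'a \<Rightarrow> 'a \<Rightarrow> real" where
  "orbit_sum T n x y = (\<Sum>i<n. dist ((T ^^ i) x) ((T ^^ i) y))"

lemma orbit_mean_less_iff: "n \<ge> 1 \<Longrightarrow> orbit_mean T n x y < e \<longleftrightarrow> orbit_sum T n x y < e * real n"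
  by (simp add: orbit_mean_def orbit_sum_def divide_simps)

lemma orbit_sum_nonneg: "0 \<le> orbit_sum T n x y"
  by (simp add: orbit_sum_def sum_nonneg)

lemma orbit_sum_mono: "m \<le> n \<Longrightarrow> orbit_sum T m x y \<le> orbit_sum T n x y"
  unfolding orbit_sum_def by (rule sum_mono2) auto

lemma orbit_sum_commute: "orbit_sum T n x y = orbit_sum T n y x"
  by (simp add: orbit_sum_def dist_commute)

lemma orbit_sum_triangle: "orbit_sum T n x z \<le> orbit_sum T n x y + orbit_sum T n y z"
  unfolding orbit_sum_def sum.distrib[symmetric] by (intro sum_mono dist_triangle)

lemma orbit_sum_add:
  "orbit_sum T (m + n) x y = orbit_sum T m x y + orbit_sum T n ((T ^^ m) x) ((T ^^ m) y)"
  by (induction n) (simp_all add: orbit_sum_def add.commute[of m] funpow_add)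

lemma funpow_in: "T ` X \<subseteq> X \<Longrightarrow> x \<in> X \<Longrightarrow> (T ^^ n) x \<in> X"
  by (induction n) auto

lemma continuous_on_funpow:
  assumes "continuous_on X T" "T ` X \<subseteq> X"
  shows "continuous_on X (T ^^ n)"
proof (induction n)
  case (Suc n)
  have "(T ^^ n) ` X \<subseteq> X" using funpow_in[OF assms(2)] by blast
  then have "continuous_on ((T ^^ n) ` X) T" using assms(1) continuous_on_subset by blast
  then show ?case using Suc continuous_on_compose by (metis funpow.simps(2))
qed (simp add: id_def)

text \<open>A substitute for a bound \<open>e\<close> on the limsup of the averages that adds up
  along triangles and survives shifts of time. The constant \<open>C\<close> may depend on the pair;
  making it uniform is the main task.\<close>

definition mean_close :: "('a::metric_space \<Rightarrow> 'a) \<Rightarrow> real \<Rightarrow> 'a \<Rightarrow> 'a \<Rightarrow> bool" where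
  "mean_close T e x y \<longleftrightarrow> (\<exists>C. \<forall>n. orbit_sum T n x y \<le> e * real n + C)"

lemma mean_close_commute: "mean_close T e x y = mean_close T e y x"
  by (simp add: mean_close_def orbit_sum_commute)

lemma mean_close_trans:
  assumes "mean_close T e x y" "mean_close T e' y z"
  shows "mean_close T (e + e') x z"
proof -
  obtain C where C: "\<And>n. orbit_sum T n x y \<le> e * real n + C"
    using assms(1) by (auto simp: mean_close_def)
  obtain C' where C': "\<And>n. orbit_sum T n y z \<le> e' * real n + C'"
    using assms(2) by (auto simp: mean_close_def)
  have "orbit_sum T n x z \<le> (e + e') * real n + (C + C')" for n
    using C[of n] C'[of n] orbit_sum_triangle[of T n x z y] by (simp add: algebra_simps)
  then show ?thesis by (auto simp: mean_close_def)
qed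

text \<open>The sum for the shifted pair is a tail of the original one, so the delay
  \<open>m\<close> only adds \<open>e * real m\<close> to the constant and leaves the rate
  \<open>e\<close> unchanged.\<close>

lemma mean_close_funpow:
  assumes "mean_close T e x y"
  shows "mean_close T e ((T ^^ m) x) ((T ^^ m) y)"
proof -
  obtain C where C: "\<And>n. orbit_sum T n x y \<le> e * real n + C"
    using assms by (auto simp: mean_close_def)
  have "orbit_sum T n ((T ^^ m) x) ((T ^^ m) y) \<le> e * real n + (e * real m + C)" for n
    using C[of "m + n"] orbit_sum_add[of T m n x y] orbit_sum_nonneg[of T m x y]
    by (simp add: algebra_simps)
  then show ?thesis by (auto simp: mean_close_def)
qed

text \<open>Averages are below \<open>e\<close> from some index on; the finitely many earlier sums
  are absorbed into the additive constant.\<close>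

lemma mean_close_if_limsup_less:
  assumes "limsup (\<lambda>n. ereal (orbit_mean T n x y)) < ereal e" "e > 0"
  shows "mean_close T e x y"
proof -
  have "\<forall>\<^sub>F n in sequentially. ereal (orbit_mean T n x y) < ereal e"
    using assms(1) by (rule Limsup_lessD)
  then obtain N where N: "\<And>n. n \<ge> N \<Longrightarrow> orbit_mean T n x y < e"
    by (auto simp: eventually_sequentially)
  have "orbit_sum T n x y \<le> e * real n + orbit_sum T (Suc N) x y" for n
  proof (cases "n \<le> Suc N")
    case True
    then show ?thesis using orbit_sum_mono[OF True, of T x y] assms(2)
      by (simp add: add_increasing)
  next
    case False
    then have "orbit_sum T n x y < e * real n"
      using N[of n] orbit_mean_less_iff[of n T x y e] by auto
    then show ?thesis using orbit_sum_nonneg[of T "Suc N" x y] by linarith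
  qed
  then show ?thesis by (auto simp: mean_close_def)
qed

lemma mean_close_ex_less:
  assumes "mean_close T e x y" "e < e'"
  shows "\<exists>n\<ge>1. orbit_sum T n x y < e' * real n"
proof -
  obtain C where C: "\<And>n. orbit_sum T n x y \<le> e * real n + C"
    using assms(1) by (auto simp: mean_close_def)
  obtain n where n: "C / (e' - e) < real n" using reals_Archimedean2 by blast
  \<comment> \<open>The gap between the two rates outgrows the constant; passing to
    \<open>Suc n\<close> also makes the witness at least 1.\<close>
  have "C < (e' - e) * real (Suc n)"
    using n assms(2) by (simp add: divide_simps algebra_simps)
  then have "orbit_sum T (Suc n) x y < e' * real (Suc n)"
    using C[of "Suc n"] by (simp add: algebra_simps)
  then show ?thesis by (intro exI[of _ "Suc n"]) simp
qed

lemma orbit_sum_tendsto: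
  assumes "continuous_on X T" "T ` X \<subseteq> X" "a \<longlonglongrightarrow> x" "b \<longlonglongrightarrow> y"
    and "\<And>k. a k \<in> X" "\<And>k. b k \<in> X" "x \<in> X" "y \<in> X"
  shows "(\<lambda>k. orbit_sum T n (a k) (b k)) \<longlonglongrightarrow> orbit_sum T n x y"
proof -
  have "(\<lambda>k. (T ^^ i) (a k)) \<longlonglongrightarrow> (T ^^ i) x" "(\<lambda>k. (T ^^ i) (b k)) \<longlonglongrightarrow> (T ^^ i) y" for i
    using continuous_on_tendsto_compose[OF continuous_on_funpow[OF assms(1,2)] assms(3)]
      continuous_on_tendsto_compose[OF continuous_on_funpow[OF assms(1,2)] assms(4)] assms(5-8)
    by simp_all
  then show ?thesis unfolding orbit_sum_def by (intro tendsto_sum tendsto_dist)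
qed

text \<open>Pairs violating the claim for larger and larger \<open>N\<close> accumulate at some pair
  \<open>q\<close>. The limit has large sums for every \<open>n\<close>, yet its coordinates are
  within \<delta> of those of a \<open>mean_close\<close> pair, and this forces a smaller growth
  rate. The limit itself need not be \<open>mean_close\<close> with rate \<open>e\<close>, hence the
  weaker factor 4.\<close>

lemma mean_close_uniform_block:
  assumes "compact X" "continuous_on X T" "T ` X \<subseteq> X" "e > 0" "\<delta> > 0"
    and near: "\<And>x y. x \<in> X \<Longrightarrow> y \<in> X \<Longrightarrow> dist x y < \<delta> \<Longrightarrow> mean_close T e x y"
  shows "\<exists>N. \<forall>x\<in>X. \<forall>y\<in>X. mean_close T e x y \<longrightarrow>
    (\<exists>n. 1 \<le> n \<and> n \<le> N \<and> orbit_sum T n x y < 4 * e * real n)"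
proof (rule ccontr)
  assume "\<not> ?thesis"
  then have "\<forall>N. \<exists>p. fst p \<in> X \<and> snd p \<in> X \<and> mean_close T e (fst p) (snd p) \<and>
      (\<forall>n. 1 \<le> n \<and> n \<le> N \<longrightarrow> orbit_sum T n (fst p) (snd p) \<ge> 4 * e * real n)"
    by (simp add: not_less) blast
  then obtain p where p: "\<And>N. fst (p N) \<in> X" "\<And>N. snd (p N) \<in> X"
      "\<And>N. mean_close T e (fst (p N)) (snd (p N))"
      "\<And>N n. 1 \<le> n \<Longrightarrow> n \<le> N \<Longrightarrow> orbit_sum T n (fst (p N)) (snd (p N)) \<ge> 4 * e * real n"
    by metis
  have "seq_compact (X \<times> X)"
    using assms(1) compact_Times compact_imp_seq_compact by blast
  moreover have "\<forall>N. p N \<in> X \<times> X" using p(1,2) by (simp add: mem_Times_iff)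
  ultimately obtain q r where q: "q \<in> X \<times> X" "strict_mono r" "(p \<circ> r) \<longlonglongrightarrow> q"
    unfolding seq_compact_def by blast
  define a b where "a k = fst (p (r k))" and "b k = snd (p (r k))" for k
  define x y where "x = fst q" and "y = snd q"
  have xy: "x \<in> X" "y \<in> X" using q(1) by (auto simp: x_def y_def)
  have lim: "a \<longlonglongrightarrow> x" "b \<longlonglongrightarrow> y"
    using tendsto_fst[OF q(3)] tendsto_snd[OF q(3)]
    by (simp_all add: a_def[abs_def] b_def[abs_def] x_def y_def)
  have ab: "\<And>k. a k \<in> X" "\<And>k. b k \<in> X" using p(1,2) by (auto simp: a_def b_def)
  \<comment> \<open>For fixed \<open>n\<close>, every \<open>k \<ge> n\<close> has
    \<open>r k \<ge> n\<close>, so the lower bound holds on a tail of the subsequence and passes to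
    the limit by continuity.\<close>
  have large: "orbit_sum T n x y \<ge> 4 * e * real n" if "n \<ge> 1" for n
  proof (rule tendsto_lowerbound[OF orbit_sum_tendsto[OF assms(2,3) lim ab xy]])
    show "\<forall>\<^sub>F k in sequentially. 4 * e * real n \<le> orbit_sum T n (a k) (b k)"
      using p(4)[OF that] seq_suble[OF q(2)]
      by (auto simp: eventually_sequentially a_def b_def intro!: exI[of _ n] dest: order_trans)
  qed simp
  have "\<forall>\<^sub>F k in sequentially. dist (a k) x < \<delta> \<and> dist (b k) y < \<delta>"
    using lim \<open>\<delta> > 0\<close> by (intro eventually_conj tendstoD)
  then obtain k where k: "dist (a k) x < \<delta>" "dist (b k) y < \<delta>"
    by (auto simp: eventually_sequentially)
  have "mean_close T e x (a k)" "mean_close T e (a k) (b k)" "mean_close T e (b k) y"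
    using near[OF ab(1) xy(1) k(1)] near[OF ab(2) xy(2) k(2)] p(3)
    by (simp_all add: mean_close_commute[of T e x] a_def b_def)
  \<comment> \<open>The detour through \<open>a k\<close> and \<open>b k\<close> costs three times
    \<open>e\<close>, strictly less than the rate \<open>4 * e\<close> in
    \<open>large\<close>.\<close>
  then have "mean_close T (e + (e + e)) x y" by (intro mean_close_trans)
  then obtain n where "n \<ge> 1" "orbit_sum T n x y < 4 * e * real n"
    using mean_close_ex_less[of T "e + (e + e)" x y "4 * e"] \<open>e > 0\<close> by auto
  with large show False by (simp add: not_less[symmetric])
qed

text \<open>Cut off an initial block of length at most \<open>N\<close> with average below
  \<open>c\<close>; the shifted pair is again \<open>mean_close\<close>, so this can be repeated.
  Only the last piece, of length at most \<open>N\<close>, is estimated trivially, and the resulting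
  constant \<open>real N * D\<close> is the same for all pairs.\<close>

lemma mean_close_uniform_bound:
  assumes "T ` X \<subseteq> X" "x \<in> X" "y \<in> X" "mean_close T e x y"
    and D: "\<And>x y. x \<in> X \<Longrightarrow> y \<in> X \<Longrightarrow> dist x y \<le> D"
    and N: "\<And>x y. x \<in> X \<Longrightarrow> y \<in> X \<Longrightarrow> mean_close T e x y \<Longrightarrow>
      \<exists>n. 1 \<le> n \<and> n \<le> N \<and> orbit_sum T n x y < c * real n"
    and "c \<ge> 0"
  shows "orbit_sum T n x y \<le> c * real n + real N * D"
  using assms(2-4)
proof (induction n arbitrary: x y rule: less_induct)
  case (less n)
  have "D \<ge> 0" using D[of x x] less.prems by simp
  show ?case
  proof (cases "n \<le> N")
    case True
    have "orbit_sum T n x y \<le> (\<Sum>i<n. D)"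
      unfolding orbit_sum_def by (intro sum_mono D funpow_in assms(1) less.prems)
    also have "\<dots> \<le> real N * D" using True \<open>D \<ge> 0\<close> by (simp add: mult_right_mono)
    finally show ?thesis using \<open>c \<ge> 0\<close> by (simp add: add_increasing)
  next
    case False
    obtain m where m: "1 \<le> m" "m \<le> N" "orbit_sum T m x y < c * real m"
      using N less.prems by blast
    \<comment> \<open>The induction hypothesis applies since \<open>m \<ge> 1\<close>, and
      \<open>m \<le> N < n\<close> keeps the subtraction from being truncated.\<close>
    have "orbit_sum T (n - m) ((T ^^ m) x) ((T ^^ m) y) \<le> c * real (n - m) + real N * D"
      using m False by (intro less.IH funpow_in assms(1) less.prems mean_close_funpow) auto
    moreover have "orbit_sum T n x y =
        orbit_sum T m x y + orbit_sum T (n - m) ((T ^^ m) x) ((T ^^ m) y)"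
      using orbit_sum_add[of T m "n - m" x y] m False by simp
    moreover have "c * real n = c * real m + c * real (n - m)"
      using m False by (simp add: of_nat_diff algebra_simps)
    ultimately show ?thesis using m(3) by linarith
  qed
qed

text \<open>Finitely many iterates are uniformly continuous on \<open>X\<close> with a common
  modulus. This handles the short averages, for which the additive constant is not yet
  negligible.\<close>

lemma uniformly_close_initial_orbits:
  assumes "compact X" "continuous_on X T" "T ` X \<subseteq> X" "e > 0"
  shows "\<exists>\<delta>>0. \<forall>x\<in>X. \<forall>y\<in>X. dist x y < \<delta> \<longrightarrow> (\<forall>i<M. dist ((T ^^ i) x) ((T ^^ i) y) < e)"
proof (induction M)
  case 0
  show ?case by (intro exI[of _ 1]) simp
next
  case (Suc M)
  then obtain d where d: "d > 0"
      "\<forall>x\<in>X. \<forall>y\<in>X. dist x y < d \<longrightarrow> (\<forall>i<M. dist ((T ^^ i) x) ((T ^^ i) y) < e)"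
    by blast
  have "uniformly_continuous_on X (T ^^ M)"
    using assms continuous_on_funpow compact_uniformly_continuous by blast
  then obtain d' where d': "d' > 0"
      "\<forall>x\<in>X. \<forall>y\<in>X. dist x y < d' \<longrightarrow> dist ((T ^^ M) x) ((T ^^ M) y) < e"
    unfolding uniformly_continuous_on_def using \<open>e > 0\<close> by (metis dist_commute)
  show ?case using d d' by (intro exI[of _ "min d d'"]) (auto simp: less_Suc_eq)
qed

lemma mean_equicontinuous_imp_in_the_mean:
  assumes "topological_dynamical_system X T" "mean_equicontinuous X T"
  shows "equicontinuous_in_the_mean X T"
  unfolding equicontinuous_in_the_mean_def
proof (intro allI impI)
  fix \<epsilon> :: real assume "\<epsilon> > 0"
  have X: "compact X" "continuous_on X T" "T ` X \<subseteq> X"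
    using assms(1) by (auto simp: topological_dynamical_system_def)
  \<comment> \<open>Blocks have rate \<open>4 * e\<close>, half of \<epsilon>; the other half is
    reserved for the additive constant.\<close>
  define e where "e = \<epsilon> / 8"
  have "e > 0" using \<open>\<epsilon> > 0\<close> by (simp add: e_def)
  obtain \<delta> where "\<delta> > 0" and
      near: "\<And>x y. x \<in> X \<Longrightarrow> y \<in> X \<Longrightarrow> dist x y < \<delta> \<Longrightarrow> mean_close T e x y"
    using assms(2) \<open>e > 0\<close> mean_close_if_limsup_less unfolding mean_equicontinuous_def by metis
  obtain N where N: "\<And>x y. x \<in> X \<Longrightarrow> y \<in> X \<Longrightarrow> mean_close T e x y \<Longrightarrow>
      \<exists>n. 1 \<le> n \<and> n \<le> N \<and> orbit_sum T n x y < 4 * e * real n"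
    using mean_close_uniform_block[OF X \<open>e > 0\<close> \<open>\<delta> > 0\<close> near] by blast
  have D: "dist x y \<le> diameter X" if "x \<in> X" "y \<in> X" for x y
    using diameter_bounded_bound compact_imp_bounded X(1) that by blast
  \<comment> \<open>Beyond \<open>M\<close>, the constant \<open>real N * diameter X\<close> is less
    than \<open>4 * e * real n\<close>.\<close>
  obtain M where M: "real N * diameter X / (4 * e) < real M" using reals_Archimedean2 by blast
  obtain d where d: "d > 0"
      "\<forall>x\<in>X. \<forall>y\<in>X. dist x y < d \<longrightarrow> (\<forall>i<M. dist ((T ^^ i) x) ((T ^^ i) y) < \<epsilon>)"
    using uniformly_close_initial_orbits[OF X \<open>\<epsilon> > 0\<close>] by blast
  have "orbit_mean T n x y < \<epsilon>"
    if n: "n \<ge> 1" and xy: "x \<in> X" "y \<in> X" "dist x y < min \<delta> d" for n x y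
  proof (cases "n \<le> M")
    case True
    have "orbit_sum T n x y < (\<Sum>i<n. \<epsilon>)"
      unfolding orbit_sum_def using d(2) xy n True
      by (intro sum_strict_mono) (auto simp: lessThan_empty_iff)
    then show ?thesis using n by (simp add: orbit_mean_less_iff mult.commute)
  next
    case False
    have "orbit_sum T n x y \<le> 4 * e * real n + real N * diameter X"
      using mean_close_uniform_bound[OF X(3) xy(1,2) _ D N] near xy \<open>e > 0\<close> by auto
    also have "real N * diameter X < 4 * e * real M"
      using M \<open>e > 0\<close> by (simp add: divide_simps mult.commute)
    also have "4 * e * real M \<le> 4 * e * real n" using False \<open>e > 0\<close> by simp
    finally show ?thesis using n by (simp add: orbit_mean_less_iff e_def)
  qed
  then show "\<exists>\<delta>>0. \<forall>n\<ge>1. \<forall>x\<in>X. \<forall>y\<in>X. dist x y < \<delta> \<longrightarrow> orbit_mean T n x y < \<epsilon>"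
    using \<open>\<delta> > 0\<close> d(1) by (intro exI[of _ "min \<delta> d"]) auto
qed

lemma equicontinuous_in_the_mean_imp_mean:
  assumes "equicontinuous_in_the_mean X T"
  shows "mean_equicontinuous X T"
  unfolding mean_equicontinuous_def
proof (intro allI impI)
  fix \<epsilon> :: real assume "\<epsilon> > 0"
  then obtain \<delta> where \<delta>: "\<delta> > 0"
      "\<forall>n\<ge>1. \<forall>x\<in>X. \<forall>y\<in>X. dist x y < \<delta> \<longrightarrow> orbit_mean T n x y < \<epsilon> / 2"
    using assms unfolding equicontinuous_in_the_mean_def by (meson half_gt_zero)
  have "limsup (\<lambda>n. ereal (orbit_mean T n x y)) < ereal \<epsilon>"
    if "x \<in> X" "y \<in> X" "dist x y < \<delta>" for x y
  proof -
    \<comment> \<open>A strict bound on all averages becomes non-strict in the limit superior, which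
      is why \<delta> was chosen for half of \<epsilon>.\<close>
    have "limsup (\<lambda>n. ereal (orbit_mean T n x y)) \<le> ereal (\<epsilon> / 2)"
      using \<delta>(2) that
      by (intro Limsup_bounded) (auto simp: eventually_sequentially less_imp_le intro!: exI[of _ 1])
    also have "\<dots> < ereal \<epsilon>" using \<open>\<epsilon> > 0\<close> by simp
    finally show ?thesis .
  qed
  then show "\<exists>\<delta>>0. \<forall>x\<in>X. \<forall>y\<in>X. dist x y < \<delta> \<longrightarrow>
      limsup (\<lambda>n. ereal (orbit_mean T n x y)) < ereal \<epsilon>"
    using \<delta>(1) by blast
qed

theorem theorem3p8:
  fixes X :: "'a::metric_space set" and T :: "'a \<Rightarrow> 'a"
  assumes "topological_dynamical_system X T"
  shows "mean_equicontinuous X T \<longleftrightarrow> equicontinuous_in_the_mean X T"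
  using mean_equicontinuous_imp_in_the_mean[OF assms] equicontinuous_in_the_mean_imp_mean by blast

end
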